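(* For every integer $n \geq 3$ with $n \neq 5$, Left wins the Classic Variant of the Mixed Deletion Game played on the cycle $C_n$ regardless of which player moves first.
   Context: The Classic Variant of the Mixed Deletion Game is a two-player combinatorial game between Left and Right played on a finite simple undirected graph; players alternate turns. On her turn Left deletes one vertex together with all edges incident to it; on his turn Right deletes one edge. The game ends when a deletion creates an isolated vertex (a vertex of degree $0$), and the player whose deletion created an isolated vertex loses; thus a legal move is a deletion which does not create an isolated vertex, and a player with no legal move loses. $C_n$ denotes the cycle graph on $n$ vertices. *)

theory Defs
  imports Main
begin

text \<open>A graph is a pair of a vertex set and a set of edges, an edge being a two-element set of
  vertices.\<close>

type_synonym 'a graph = "'a set \<times> 'a set set"

abbreviation verts :: "'a graph \<Rightarrow> 'a set" where
  "verts G \<equiv> fst G"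

abbreviation edges :: "'a graph \<Rightarrow> 'a set set" where
  "edges G \<equiv> snd G"

definition finite_simple_graph :: "'a graph \<Rightarrow> bool" where
  "finite_simple_graph G \<longleftrightarrow> finite (verts G) \<and> (\<forall>e \<in> edges G. e \<subseteq> verts G \<and> card e = 2)"

definition degree :: "'a graph \<Rightarrow> 'a \<Rightarrow> nat" where
  "degree G v = card {e \<in> edges G. v \<in> e}"

definition isolated :: "'a graph \<Rightarrow> 'a \<Rightarrow> bool" where
  "isolated G v \<longleftrightarrow> v \<in> verts G \<and> degree G v = 0"

definition delete_vertex :: "'a graph \<Rightarrow> 'a \<Rightarrow> 'a graph" where
  "delete_vertex G v = (verts G - {v}, {e \<in> edges G. v \<notin> e})"

definition delete_edge :: "'a graph \<Rightarrow> 'a set \<Rightarrow> 'a graph" where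
  "delete_edge G e = (verts G, edges G - {e})"

definition creates_isolated :: "'a graph \<Rightarrow> 'a graph \<Rightarrow> bool" where
  "creates_isolated G H \<longleftrightarrow> (\<exists>v. isolated H v \<and> \<not> isolated G v)"

datatype player = Left | Right

fun opponent :: "player \<Rightarrow> player" where
  "opponent Left = Right"
| "opponent Right = Left"

fun deletion :: "player \<Rightarrow> 'a graph \<Rightarrow> 'a graph \<Rightarrow> bool" where
  "deletion Left G H \<longleftrightarrow> (\<exists>v \<in> verts G. H = delete_vertex G v)"
| "deletion Right G H \<longleftrightarrow> (\<exists>e \<in> edges G. H = delete_edge G e)"

definition legal_move :: "player \<Rightarrow> 'a graph \<Rightarrow> 'a graph \<Rightarrow> bool" where
  "legal_move p G H \<longleftrightarrow> deletion p G H \<and> \<not> creates_isolated G H"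

text \<open>\<open>wins p q G\<close>: player \<open>p\<close> has a winning strategy from position \<open>G\<close> with player \<open>q\<close> to move.
  The second rule includes the case where the opponent to move has no legal move and so loses.
  Since each move strictly shrinks a finite graph, every play ends, and the least fixed point is
  the right notion.\<close>

inductive wins :: "player \<Rightarrow> player \<Rightarrow> 'a graph \<Rightarrow> bool" for p :: player where
  own_turn: "legal_move p G H \<Longrightarrow> wins p (opponent p) H \<Longrightarrow> wins p p G"
| opponent_turn: "(\<And>H. legal_move (opponent p) G H \<Longrightarrow> wins p p H) \<Longrightarrow> wins p (opponent p) G"

definition cycle_graph :: "nat \<Rightarrow> nat graph" where
  "cycle_graph n = ({..<n}, {{i, Suc i mod n} | i. i < n})"

lemma finite_simple_graph_cycle_graph:
  assumes "3 \<le> n"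
  shows "finite_simple_graph (cycle_graph n)"
proof -
  have "i \<noteq> Suc i mod n" if "i < n" for i
    using that assms by (cases "Suc i = n") auto
  then show ?thesis
    using assms by (auto simp: finite_simple_graph_def cycle_graph_def card_2_iff)
qed

lemma finite_simple_graph_legal_move:
  assumes "finite_simple_graph G" and "legal_move p G H"
  shows "finite_simple_graph H"
  using assms unfolding finite_simple_graph_def legal_move_def
  by (cases p) (fastforce simp: delete_vertex_def delete_edge_def)+

end

theory Submission
  imports Defs
begin

text \<open>After the first move the position is a disjoint union of paths with at least two vertices
  each. Let \<open>D\<close> be the set of vertices of degree two. Right can reach a position with empty \<open>D\<close>,
  where Left is stuck, only if \<open>D\<close> is itself an edge, that is, from one path on four vertices
  together with paths on two vertices. Whenever \<open>D\<close> is nonempty Left can move to a position in which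
  the new \<open>D\<close> is not an edge: deleting a leaf adjacent to \<open>x\<close> turns \<open>D\<close> into \<open>D - {x}\<close>, and if that
  is an edge, then Left deletes another leaf, or the centre in case \<open>D\<close> is the interior of a path on
  five vertices. Removing a vertex from \<open>C\<^sub>n\<close> leaves a \<open>D\<close> with \<open>n - 3\<close> elements, which is not an edge
  unless \<open>n = 5\<close>.\<close>

section \<open>Degrees after a deletion\<close>

lemma finite_edges: "finite_simple_graph G \<Longrightarrow> finite (edges G)"
  by (rule finite_subset[of _ "Pow (verts G)"]) (auto simp: finite_simple_graph_def)

lemma edge_as_pair:
  assumes "finite_simple_graph G" "e \<in> edges G" "x \<in> e"
  obtains y where "e = {x, y}" "x \<noteq> y" "y \<in> verts G"
proof -
  have "card e = 2" "e \<subseteq> verts G"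
    using assms by (auto simp: finite_simple_graph_def)
  with assms(3) show thesis
    using that by (fastforce simp: card_2_iff)
qed

lemma degree_delete_edge:
  assumes "finite_simple_graph G" "e \<in> edges G"
  shows "degree (delete_edge G e) w = degree G w - (if w \<in> e then 1 else 0)"
proof -
  have "{f \<in> edges (delete_edge G e). w \<in> f} = {f \<in> edges G. w \<in> f} - {e}"
    by (auto simp: delete_edge_def)
  then show ?thesis
    using assms finite_edges[OF assms(1)] by (auto simp: degree_def card_Diff_singleton)
qed

lemma degree_delete_vertex:
  assumes "finite_simple_graph G" "w \<noteq> v"
  shows "degree (delete_vertex G v) w = degree G w - (if {v, w} \<in> edges G then 1 else 0)"
proof -
  \<comment> \<open>Edges have two elements, so at most one edge at \<open>w\<close> is
    lost.\<close>
  have "e = {v, w}" if "e \<in> edges G" "v \<in> e" "w \<in> e" for e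
    using that assms by (metis edge_as_pair insert_iff empty_iff)
  then have "{e \<in> edges (delete_vertex G v). w \<in> e} = {e \<in> edges G. w \<in> e} - {{v, w}}"
    by (auto simp: delete_vertex_def)
  then show ?thesis
    using finite_edges[OF assms(1)] by (auto simp: degree_def card_Diff_singleton)
qed

lemma degree_legal_move_le:
  assumes "finite_simple_graph G" "legal_move p G H"
  shows "degree H w \<le> degree G w"
  unfolding degree_def using assms finite_edges[OF assms(1)]
  by (cases p) (auto simp: legal_move_def delete_vertex_def delete_edge_def intro!: card_mono)

section \<open>Path forests and their inner vertices\<close>

definition inner :: "'a graph \<Rightarrow> 'a set" where
  "inner G = {v \<in> verts G. 2 \<le> degree G v}"

text \<open>Acyclicity in the form in which it is used, and which passes to subgraphs for free: a finite
  graph is a forest iff every nonempty induced subgraph has a vertex of degree at most one.\<close>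

definition forest :: "'a graph \<Rightarrow> bool" where
  "forest G \<longleftrightarrow>
    (\<forall>S \<subseteq> verts G. S \<noteq> {} \<longrightarrow> (\<exists>x \<in> S. card {e \<in> edges G. x \<in> e \<and> e \<subseteq> S} \<le> 1))"

text \<open>Component by component these are the paths with at least one edge; the vertices outside
  \<open>inner G\<close> are their leaves.\<close>

definition path_forest :: "'a graph \<Rightarrow> bool" where
  "path_forest G \<longleftrightarrow>
    finite_simple_graph G \<and> (\<forall>v \<in> verts G. 1 \<le> degree G v \<and> degree G v \<le> 2) \<and> forest G"

lemma forest_subgraph:
  assumes "forest G" "verts H \<subseteq> verts G" "edges H \<subseteq> edges G" "finite (edges G)"
  shows "forest H"
  unfolding forest_def
proof (intro allI impI)
  fix S assume S: "S \<subseteq> verts H" "S \<noteq> {}"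
  then obtain x where x: "x \<in> S" "card {e \<in> edges G. x \<in> e \<and> e \<subseteq> S} \<le> 1"
    using assms unfolding forest_def by (meson order_trans)
  have "card {e \<in> edges H. x \<in> e \<and> e \<subseteq> S} \<le> card {e \<in> edges G. x \<in> e \<and> e \<subseteq> S}"
    using assms by (intro card_mono) auto
  with x show "\<exists>x \<in> S. card {e \<in> edges H. x \<in> e \<and> e \<subseteq> S} \<le> 1"
    using order_trans by blast
qed

lemma legal_move_subgraph:
  assumes "legal_move p G H"
  shows "verts H \<subseteq> verts G" "edges H \<subseteq> edges G"
  using assms by (cases p; auto simp: legal_move_def delete_vertex_def delete_edge_def)+

text \<open>Legality only forbids new isolated vertices, so absence of isolated vertices is an
  invariant of play.\<close>

lemma no_isolated_legal_move:
  assumes "\<And>v. v \<in> verts G \<Longrightarrow> 1 \<le> degree G v" "legal_move p G H" "v \<in> verts H"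
  shows "1 \<le> degree H v"
proof -
  have "v \<in> verts G"
    using assms(3) legal_move_subgraph[OF assms(2)] by auto
  then have "\<not> isolated G v"
    using assms(1)[of v] by (auto simp: isolated_def)
  then show ?thesis
    using assms(2,3) unfolding legal_move_def creates_isolated_def isolated_def
    by (metis less_one not_less)
qed

lemma path_forest_legal_move:
  assumes "path_forest G" "legal_move p G H"
  shows "path_forest H"
proof -
  have G: "finite_simple_graph G" "forest G"
      "\<And>v. v \<in> verts G \<Longrightarrow> 1 \<le> degree G v" "\<And>v. v \<in> verts G \<Longrightarrow> degree G v \<le> 2"
    using assms by (auto simp: path_forest_def)
  note sub = legal_move_subgraph[OF assms(2)]
  have "degree H v \<le> 2" if "v \<in> verts H" for v
    using degree_legal_move_le[OF G(1) assms(2), of v] G(4)[of v] that sub by auto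
  then show ?thesis
    unfolding path_forest_def
    using G sub finite_simple_graph_legal_move[OF G(1) assms(2)]
      no_isolated_legal_move[OF G(3) assms(2)] forest_subgraph[OF G(2) sub finite_edges[OF G(1)]]
    by blast
qed

section \<open>Moves of Left\<close>

lemma legal_delete_vertex:
  assumes "v \<in> verts G" "\<And>w. w \<in> verts G \<Longrightarrow> w \<noteq> v \<Longrightarrow> 1 \<le> degree (delete_vertex G v) w"
  shows "legal_move Left G (delete_vertex G v)"
proof -
  have "\<not> isolated (delete_vertex G v) w" for w
    using assms(2)[of w] by (auto simp: isolated_def) (auto simp: delete_vertex_def)
  then show ?thesis
    using assms(1) by (auto simp: legal_move_def creates_isolated_def)
qed

text \<open>The only neighbour of the leaf \<open>l\<close> is \<open>x\<close>, so the only degree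
  that changes is that of \<open>x\<close>, which falls from two to one. Hence no vertex becomes
  isolated and just \<open>x\<close> leaves the inner set.\<close>

lemma delete_leaf:
  assumes G: "path_forest G" and x: "x \<in> inner G" and xl: "{x, l} \<in> edges G"
    and l: "l \<notin> inner G"
  shows "legal_move Left G (delete_vertex G l)" "inner (delete_vertex G l) = inner G - {x}"
proof -
  have fsg: "finite_simple_graph G" and deg: "\<And>v. v \<in> verts G \<Longrightarrow> 1 \<le> degree G v \<and> degree G v \<le> 2"
    using G by (auto simp: path_forest_def)
  have lV: "l \<in> verts G"
    using fsg xl by (auto simp: finite_simple_graph_def)
  have "degree G l = 1"
    using deg[OF lV] l lV by (auto simp: inner_def)
  then obtain f where "{e \<in> edges G. l \<in> e} = {f}"
    unfolding degree_def by (metis card_1_singletonE)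
  then have only: "e = {x, l}" if "e \<in> edges G" "l \<in> e" for e
    using that xl by (metis (mono_tags, lifting) insertI1 insert_commute mem_Collect_eq singletonD)
  have degree: "degree (delete_vertex G l) w = (if w = x then 1 else degree G w)"
    if "w \<in> verts G" "w \<noteq> l" for w
  proof -
    have "{l, w} \<in> edges G \<longleftrightarrow> w = x"
    proof
      assume "{l, w} \<in> edges G"
      then have "{l, w} = {x, l}"
        by (rule only) simp
      then show "w = x"
        using that(2) by (metis doubleton_eq_iff)
    qed (use xl in \<open>simp add: insert_commute\<close>)
    then show ?thesis
      using degree_delete_vertex[OF fsg that(2)] x deg[of x] by (auto simp: inner_def)
  qed
  show "legal_move Left G (delete_vertex G l)"
    using degree deg lV by (intro legal_delete_vertex) auto
  show "inner (delete_vertex G l) = inner G - {x}"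
  proof (rule set_eqI)
    have verts: "verts (delete_vertex G l) = verts G - {l}"
      by (simp add: delete_vertex_def)
    fix w
    show "w \<in> inner (delete_vertex G l) \<longleftrightarrow> w \<in> inner G - {x}"
    proof (cases "w \<in> verts G \<and> w \<noteq> l")
      case True
      then show ?thesis
        using degree[of w] by (simp add: inner_def verts)
    next
      case False
      then show ?thesis
        using l verts by (auto simp: inner_def)
    qed
  qed
qed

lemma exists_edge_not:
  assumes "2 \<le> degree G x" "card {e \<in> edges G. x \<in> e \<and> P e} \<le> 1"
  obtains e where "e \<in> edges G" "x \<in> e" "\<not> P e"
proof -
  have "\<exists>e \<in> edges G. x \<in> e \<and> \<not> P e"
  proof (rule ccontr)
    assume "\<not> ?thesis"
    then have "{e \<in> edges G. x \<in> e \<and> P e} = {e \<in> edges G. x \<in> e}"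
      by auto
    with assms show False
      by (simp add: degree_def)
  qed
  with that show thesis
    by blast
qed

text \<open>The inner vertices form the path \<open>x\<close>, \<open>y\<close>, \<open>z\<close>.
  Deleting \<open>y\<close> turns \<open>x\<close> and \<open>z\<close> into leaves and touches no
  other vertex.\<close>

lemma delete_centre:
  assumes G: "path_forest G" and D: "inner G = {x, y, z}"
    and ne: "x \<noteq> y" "y \<noteq> z" "x \<noteq> z" and xy: "{x, y} \<in> edges G" and yz: "{y, z} \<in> edges G"
  shows "legal_move Left G (delete_vertex G y)" "inner (delete_vertex G y) = {}"
proof -
  have fsg: "finite_simple_graph G" and deg: "\<And>v. v \<in> verts G \<Longrightarrow> 1 \<le> degree G v \<and> degree G v \<le> 2"
    using G by (auto simp: path_forest_def)
  have inV: "x \<in> verts G" "y \<in> verts G" "z \<in> verts G"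
    and deg2: "2 \<le> degree G x" "2 \<le> degree G y" "2 \<le> degree G z"
    using D unfolding inner_def by blast+
  \<comment> \<open>Degree two leaves no room for a third edge at \<open>y\<close>.\<close>
  have edges_y: "{{x, y}, {y, z}} = {e \<in> edges G. y \<in> e}"
  proof (rule card_subset_eq)
    show "finite {e \<in> edges G. y \<in> e}"
      using finite_edges[OF fsg] by simp
    show "card {{x, y}, {y, z}} = card {e \<in> edges G. y \<in> e}"
      using deg[of y] deg2 inV ne by (auto simp: degree_def doubleton_eq_iff)
  qed (use xy yz in auto)
  have "{y, w} \<in> edges G \<longleftrightarrow> {y, w} \<in> {{x, y}, {y, z}}" for w
    unfolding edges_y by simp
  then have adj: "{y, w} \<in> edges G \<longleftrightarrow> w = x \<or> w = z" if "w \<noteq> y" for w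
    using that ne by (auto simp: doubleton_eq_iff)
  have degree: "degree (delete_vertex G y) w = 1" if "w \<in> verts G" "w \<noteq> y" for w
  proof (cases "w = x \<or> w = z")
    case True
    then show ?thesis
      using degree_delete_vertex[OF fsg that(2)] adj[OF that(2)] deg[of w] deg2 that by auto
  next
    case False
    then have "w \<notin> inner G"
      using D that by auto
    then show ?thesis
      using degree_delete_vertex[OF fsg that(2)] adj[OF that(2)] deg[of w] False that
      by (auto simp: inner_def)
  qed
  show "legal_move Left G (delete_vertex G y)"
    using degree inV by (intro legal_delete_vertex) auto
  show "inner (delete_vertex G y) = {}"
    using degree by (auto simp: inner_def delete_vertex_def)
qed

lemma Left_good_move:
  assumes G: "path_forest G" and "inner G \<noteq> {}"
  obtains H where "legal_move Left G H" "inner H \<notin> edges H"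
proof -
  have fsg: "finite_simple_graph G" and forest: "forest G"
    using G by (auto simp: path_forest_def)
  have not_edge: "{} \<notin> edges H" if "legal_move Left G H" for H
    using finite_simple_graph_legal_move[OF fsg that] by (auto simp: finite_simple_graph_def)
  \<comment> \<open>A deletion adds no edges, so it suffices that the new inner set is not an edge
    of \<open>G\<close> itself.\<close>
  have leaf: thesis if "x \<in> inner G" "{x, l} \<in> edges G" "l \<notin> inner G" "inner G - {x} \<notin> edges G" for x l
    using that delete_leaf[OF G that(1-3)] legal_move_subgraph(2) \<open>\<And>H. _ \<Longrightarrow> _ \<Longrightarrow> thesis\<close> by (metis subsetD)
  have "inner G \<subseteq> verts G"
    by (auto simp: inner_def)
  \<comment> \<open>The forest condition for the set \<open>inner G\<close> gives an inner vertex
    with at most one inner neighbour; as its degree is two, another neighbour \<open>l\<close> is a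
    leaf.\<close>
  then obtain x where x: "x \<in> inner G" "card {e \<in> edges G. x \<in> e \<and> e \<subseteq> inner G} \<le> 1"
    using forest assms(2) unfolding forest_def by blast
  moreover have "2 \<le> degree G x"
    using x by (simp add: inner_def)
  ultimately obtain e where e: "e \<in> edges G" "x \<in> e" "\<not> e \<subseteq> inner G"
    using exists_edge_not[of G x "\<lambda>e. e \<subseteq> inner G"] by blast
  then obtain l where l: "{x, l} \<in> edges G" "l \<notin> inner G"
    using edge_as_pair[OF fsg e(1,2)] x(1) by (metis insert_subset empty_subsetI)
  show thesis
  proof (cases "inner G - {x} \<in> edges G")
    case False
    then show thesis
      using leaf x l by blast
  next
    case True
    then have "card (inner G - {x}) = 2"
      using fsg by (auto simp: finite_simple_graph_def)
    then obtain y z where yz: "inner G - {x} = {y, z}" "y \<noteq> z"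
      by (auto simp: card_2_iff)
    then have D: "inner G = {x, y, z}" and ne: "x \<noteq> y" "x \<noteq> z" and yzE: "{y, z} \<in> edges G"
      using x True by auto
    consider "{x, y} \<in> edges G" | "{x, z} \<in> edges G" | "{x, y} \<notin> edges G" "{x, z} \<notin> edges G"
      by blast
    then show thesis
    proof cases
      \<comment> \<open>Here \<open>y\<close> is the centre of the inner path, and deleting it
        empties the inner set, which is then no edge. The next case has \<open>z\<close> as
        centre.\<close>
      case 1
      then show thesis
        using delete_centre[OF G D] ne yz(2) yzE not_edge that by metis
    next
      case 2
      have "inner G = {x, z, y}"
        using D by auto
      with 2 show thesis
        using delete_centre[OF G, of x z y] ne yz(2) yzE not_edge that by (metis insert_commute)
    next
      \<comment> \<open>Now \<open>x\<close> is adjacent to neither \<open>y\<close> nor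
        \<open>z\<close>, so the second neighbour \<open>m\<close> of \<open>y\<close> is a leaf.
        Deleting \<open>m\<close> leaves the inner set \<open>{x, z}\<close>, a non-edge.\<close>
      case 3
      have "{e \<in> edges G. y \<in> e \<and> e = {y, z}} \<subseteq> {{y, z}}"
        by auto
      then have "card {e \<in> edges G. y \<in> e \<and> e = {y, z}} \<le> 1"
        using card_mono[of "{{y, z}}"] by fastforce
      moreover have "2 \<le> degree G y"
        using D unfolding inner_def by blast
      ultimately obtain e where e: "e \<in> edges G" "y \<in> e" "e \<noteq> {y, z}"
        using exists_edge_not[of G y "\<lambda>e. e = {y, z}"] by blast
      then obtain m where m: "e = {y, m}" "y \<noteq> m"
        using edge_as_pair[OF fsg e(1,2)] by metis
      have "m \<notin> inner G"
        using D m e 3 by (auto simp: insert_commute)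
      moreover have "inner G - {y} \<notin> edges G"
        using D ne yz 3 by (simp add: insert_Diff_if)
      ultimately show thesis
        using leaf[of y m] D e(1) m by auto
    qed
  qed
qed

section \<open>Moves of Right and the induction\<close>

text \<open>A legal edge deletion leaves both ends of \<open>e\<close> with positive degree, so both
  were inner. Since \<open>e\<close> is not the whole of \<open>inner G\<close>, some inner vertex
  lies off \<open>e\<close> and keeps its degree.\<close>

lemma inner_after_Right:
  assumes fsg: "finite_simple_graph G" and "\<And>v. v \<in> verts G \<Longrightarrow> 1 \<le> degree G v"
    and "inner G \<notin> edges G" and H: "legal_move Right G H"
  shows "inner H \<noteq> {}"
proof -
  obtain e where e: "e \<in> edges G" "H = delete_edge G e"
    using H by (auto simp: legal_move_def)
  have "v \<in> inner G" if "v \<in> e" for v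
  proof -
    have "v \<in> verts G"
      using fsg e that by (auto simp: finite_simple_graph_def)
    then have "1 \<le> degree H v"
      using no_isolated_legal_move[OF assms(2) H] e by (auto simp: delete_edge_def)
    then show ?thesis
      using degree_delete_edge[OF fsg e(1), of v] that e \<open>v \<in> verts G\<close> by (auto simp: inner_def)
  qed
  moreover have "e \<noteq> inner G"
    using assms(3) e by auto
  ultimately obtain w where "w \<in> inner G" "w \<notin> e"
    by blast
  then have "w \<in> inner H"
    using degree_delete_edge[OF fsg e(1), of w] e by (auto simp: inner_def delete_edge_def)
  then show ?thesis
    by auto
qed

lemma legal_move_size:
  assumes "finite_simple_graph G" "legal_move p G H"
  shows "card (verts H) + card (edges H) < card (verts G) + card (edges G)"
proof -
  have fin: "finite (verts G)" "finite (edges G)"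
    using assms(1) finite_edges[OF assms(1)] by (auto simp: finite_simple_graph_def)
  have sub: "verts H \<subseteq> verts G" "edges H \<subseteq> edges G"
    using legal_move_subgraph[OF assms(2)] by auto
  have "verts H \<subset> verts G \<or> edges H \<subset> edges G"
    using assms by (cases p) (auto simp: legal_move_def delete_vertex_def delete_edge_def)
  then show ?thesis
    using fin sub by (metis add_less_le_mono add_le_less_mono card_mono psubset_card_mono)
qed

text \<open>The two claims feed each other: with Left to move, a good move leads to the second claim
  for a smaller graph; with Right to move, every legal move leads to the first.\<close>

lemma Left_wins_path_forest:
  assumes "path_forest G"
  shows "(inner G \<noteq> {} \<longrightarrow> wins Left Left G) \<and> (inner G \<notin> edges G \<longrightarrow> wins Left Right G)"
  using assms
proof (induction "card (verts G) + card (edges G)" arbitrary: G rule: less_induct)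
  case less
  have fsg: "finite_simple_graph G" and deg: "\<And>v. v \<in> verts G \<Longrightarrow> 1 \<le> degree G v"
    using less.prems by (auto simp: path_forest_def)
  have IH: "(inner H \<noteq> {} \<longrightarrow> wins Left Left H) \<and> (inner H \<notin> edges H \<longrightarrow> wins Left Right H)"
    if "legal_move p G H" for p H
    using less.hyps legal_move_size[OF fsg that] path_forest_legal_move[OF less.prems that] by blast
  show ?case
  proof (intro conjI impI)
    assume "inner G \<noteq> {}"
    then obtain H where "legal_move Left G H" "inner H \<notin> edges H"
      using Left_good_move less.prems by blast
    then show "wins Left Left G"
      using IH own_turn by fastforce
  next
    assume "inner G \<notin> edges G"
    then show "wins Left Right G"
      using opponent_turn[of Left G] IH inner_after_Right[OF fsg deg] by fastforce
  qed
qed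

section \<open>The cycle and its first move\<close>

lemma Suc_mod_inj:
  assumes "i < n" "j < n" "Suc i mod n = Suc j mod n"
  shows "i = (j :: nat)"
  using assms by (metis Suc_lessI mod_less mod_self nat.inject old.nat.distinct(1))

text \<open>A nonempty set closed under the cyclic successor contains a full orbit, which is all of
  \<open>{..<n}\<close>.\<close>

lemma cyclic_exit:
  assumes "S \<subset> {..<n}" "S \<noteq> {}"
  obtains x where "x \<in> S" "Suc x mod n \<notin> S"
proof (rule ccontr)
  assume "\<not> thesis"
  with that have closed: "Suc x mod n \<in> S" if "x \<in> S" for x
    using that by blast
  obtain a where a: "a \<in> S" "a < n"
    using assms by auto
  have orbit: "(a + k) mod n \<in> S" for k
  proof (induction k)
    case (Suc k)
    then show ?case
      using closed[OF Suc] by (simp add: mod_Suc_eq)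
  qed (use a in simp)
  \<comment> \<open>Going round from \<open>a\<close> to \<open>b\<close> takes
    \<open>b + n - a\<close> steps modulo \<open>n\<close>; the summand \<open>n\<close> keeps the
    natural subtraction from truncating.\<close>
  have "b \<in> S" if "b < n" for b
    using orbit[of "b + n - a"] a that by simp
  with assms show False
    by auto
qed

text \<open>The edge from \<open>x\<close> to its successor leaves \<open>S\<close>, so only the
  edge from the predecessor, unique by \<open>Suc_mod_inj\<close>, can remain.\<close>

lemma cycle_edges_in:
  assumes "x < n" "Suc x mod n \<notin> S"
  shows "card {e \<in> edges (cycle_graph n). x \<in> e \<and> e \<subseteq> S} \<le> 1"
proof -
  have "e = f"
    if "e \<in> edges (cycle_graph n)" "x \<in> e" "e \<subseteq> S" "f \<in> edges (cycle_graph n)" "x \<in> f" "f \<subseteq> S" for e f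
    using that assms Suc_mod_inj[of _ n] by (auto simp: cycle_graph_def)
  moreover have "finite {e \<in> edges (cycle_graph n). x \<in> e \<and> e \<subseteq> S}"
    by (auto simp: cycle_graph_def)
  ultimately show ?thesis
    by (simp add: card_le_Suc0_iff_eq)
qed

lemma cycle_graph_edge: "i < n \<Longrightarrow> {i, Suc i mod n} \<in> edges (cycle_graph n)"
  by (auto simp: cycle_graph_def)

lemma degree_cycle_graph:
  assumes "3 \<le> n" "x < n"
  shows "degree (cycle_graph n) x = 2"
proof -
  \<comment> \<open>The cyclic predecessor of \<open>x\<close>.\<close>
  define p where "p = (if x = 0 then n - 1 else x - 1)"
  have p: "p < n" "Suc p mod n = x"
    using assms by (auto simp: p_def)
  have "e = {p, x} \<or> e = {x, Suc x mod n}" if e: "e \<in> edges (cycle_graph n)" "x \<in> e" for e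
  proof -
    obtain i where i: "i < n" "e = {i, Suc i mod n}"
      using e(1) by (auto simp: cycle_graph_def)
    then consider "x = i" | "x = Suc i mod n"
      using e(2) by blast
    then show ?thesis
    proof cases
      case 2
      then have "i = p"
        using Suc_mod_inj[OF i(1) p(1)] p(2) by simp
      then show ?thesis
        using i(2) p(2) by simp
    qed (use i(2) in simp)
  qed
  moreover have "{p, x} \<in> edges (cycle_graph n)" "{x, Suc x mod n} \<in> edges (cycle_graph n)"
    using cycle_graph_edge[OF p(1)] cycle_graph_edge[OF assms(2)] p(2) by simp_all
  ultimately have "{e \<in> edges (cycle_graph n). x \<in> e} = {{p, x}, {x, Suc x mod n}}"
    by (intro equalityI subsetI) (auto simp only: mem_Collect_eq insert_iff empty_iff)
  \<comment> \<open>This is where \<open>3 \<le> n\<close> matters: for \<open>n = 2\<close> both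
    edges at \<open>x\<close> would coincide.\<close>
  moreover have "p \<noteq> Suc x mod n" "x \<noteq> p"
    using assms by (auto simp: p_def mod_Suc)
  ultimately show ?thesis
    by (auto simp: degree_def doubleton_eq_iff)
qed

text \<open>A proper subset of the cycle has an exit, whose vertex has at most one edge inside. The
  full vertex set survives only an edge deletion, and then an end of the deleted edge has degree
  one.\<close>

lemma forest_cycle_legal_move:
  assumes n: "3 \<le> n" and H: "legal_move p (cycle_graph n) H"
  shows "forest H"
  unfolding forest_def
proof (intro allI impI)
  fix S assume S: "S \<subseteq> verts H" "S \<noteq> {}"
  note sub = legal_move_subgraph[OF H]
  have V: "verts (cycle_graph n) = {..<n}"
    by (simp add: cycle_graph_def)
  have fin: "finite (edges (cycle_graph n))"
    using finite_edges finite_simple_graph_cycle_graph[OF n] by blast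
  show "\<exists>x \<in> S. card {e \<in> edges H. x \<in> e \<and> e \<subseteq> S} \<le> 1"
  proof (cases "S = {..<n}")
    case False
    then have "S \<subset> {..<n}"
      using S sub V by auto
    then obtain x where x: "x \<in> S" "Suc x mod n \<notin> S"
      using cyclic_exit S(2) by blast
    have "card {e \<in> edges H. x \<in> e \<and> e \<subseteq> S} \<le> card {e \<in> edges (cycle_graph n). x \<in> e \<and> e \<subseteq> S}"
      using sub fin by (intro card_mono) auto
    also have "\<dots> \<le> 1"
      using cycle_edges_in x \<open>S \<subset> _\<close> by blast
    finally show ?thesis
      using x by auto
  next
    case True
    then have "verts H = verts (cycle_graph n)"
      using S sub V by auto
    then obtain e where e: "e \<in> edges (cycle_graph n)" "H = delete_edge (cycle_graph n) e"
      using H by (cases p) (auto simp: legal_move_def delete_vertex_def)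
    then obtain i where i: "i < n" "i \<in> e"
      by (auto simp: cycle_graph_def)
    have "card {e \<in> edges H. i \<in> e \<and> e \<subseteq> S} \<le> degree H i"
      unfolding degree_def using finite_subset[OF sub(2) fin] by (intro card_mono) auto
    also have "\<dots> = 1"
      using degree_delete_edge[OF finite_simple_graph_cycle_graph[OF n] e(1), of i]
        degree_cycle_graph[OF n i(1)] i e by simp
    finally show ?thesis
      using i True by auto
  qed
qed

lemma path_forest_cycle_legal_move:
  assumes n: "3 \<le> n" and H: "legal_move p (cycle_graph n) H"
  shows "path_forest H"
proof -
  note fsg = finite_simple_graph_cycle_graph[OF n]
  have deg: "degree (cycle_graph n) v = 2" if "v \<in> verts (cycle_graph n)" for v
    using degree_cycle_graph[OF n] that by (auto simp: cycle_graph_def)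
  then have "degree H v \<le> 2" if "v \<in> verts H" for v
    using degree_legal_move_le[OF fsg H, of v] legal_move_subgraph(1)[OF H] that by fastforce
  moreover have "1 \<le> degree H v" if "v \<in> verts H" for v
    using no_isolated_legal_move[OF _ H that] deg by simp
  ultimately show ?thesis
    using forest_cycle_legal_move[OF n H] finite_simple_graph_legal_move[OF fsg H]
    by (auto simp: path_forest_def)
qed

text \<open>Choosing the vertex \<open>n - 1\<close> leaves the path \<open>0, ..., n - 2\<close>
  without any renumbering; its two ends are the only vertices that drop to degree one.\<close>

lemma delete_vertex_cycle_graph:
  assumes n: "3 \<le> n"
  shows "legal_move Left (cycle_graph n) (delete_vertex (cycle_graph n) (n - 1))"
    and "card (inner (delete_vertex (cycle_graph n) (n - 1))) = n - 3"
proof -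
  note fsg = finite_simple_graph_cycle_graph[OF n]
  have adj: "{n - 1, w} \<in> edges (cycle_graph n) \<longleftrightarrow> w = 0 \<or> w = n - 2" if "w < n" "w \<noteq> n - 1" for w
  proof
    assume "{n - 1, w} \<in> edges (cycle_graph n)"
    then obtain i where "i < n" "{n - 1, w} = {i, Suc i mod n}"
      by (auto simp: cycle_graph_def)
    then show "w = 0 \<or> w = n - 2"
      using that by (auto simp: doubleton_eq_iff mod_Suc split: if_splits)
  next
    have "{n - 1, 0} \<in> edges (cycle_graph n)"
      using cycle_graph_edge[of "n - 1" n] n by simp
    moreover have "Suc (n - 2) mod n = n - 1"
      using n by auto
    then have "{n - 1, n - 2} \<in> edges (cycle_graph n)"
      using cycle_graph_edge[of "n - 2" n] n by (simp add: insert_commute)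
    moreover assume "w = 0 \<or> w = n - 2"
    ultimately show "{n - 1, w} \<in> edges (cycle_graph n)"
      by auto
  qed
  have degree: "degree (delete_vertex (cycle_graph n) (n - 1)) w = (if w = 0 \<or> w = n - 2 then 1 else 2)"
    if "w < n" "w \<noteq> n - 1" for w
    using degree_delete_vertex[OF fsg that(2)] degree_cycle_graph[OF n that(1)] adj[OF that] by auto
  then show "legal_move Left (cycle_graph n) (delete_vertex (cycle_graph n) (n - 1))"
    using n by (intro legal_delete_vertex) (auto simp: cycle_graph_def)
  have "inner (delete_vertex (cycle_graph n) (n - 1)) = {..<n} - {n - 1, n - 2, 0}"
    using degree by (auto simp: inner_def delete_vertex_def cycle_graph_def)
  moreover have "card {n - 1, n - 2, 0} = 3"
    using n by auto
  ultimately show "card (inner (delete_vertex (cycle_graph n) (n - 1))) = n - 3"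
    using n by (simp add: card_Diff_subset)
qed

theorem theorem3p5:
  fixes n :: nat
  assumes "3 \<le> n" and "n \<noteq> 5"
  shows "\<forall>first :: player. wins player.Left first (cycle_graph n)"
proof
  fix first :: player
  note fsg = finite_simple_graph_cycle_graph[OF assms(1)]
  show "wins Left first (cycle_graph n)"
  proof (cases first)
    case Left
    let ?H = "delete_vertex (cycle_graph n) (n - 1)"
    note H = delete_vertex_cycle_graph[OF assms(1)]
    \<comment> \<open>An edge has two elements, and \<open>n - 3 = 2\<close> is excluded by
      \<open>n \<noteq> 5\<close>.\<close>
    have "inner ?H \<notin> edges ?H"
      using H(2) assms finite_simple_graph_legal_move[OF fsg H(1)]
      by (auto simp: finite_simple_graph_def)
    then have "wins Left Right ?H"
      using Left_wins_path_forest path_forest_cycle_legal_move[OF assms(1) H(1)] by blast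
    then show ?thesis
      using own_turn[OF H(1)] Left by simp
  next
    case Right
    have inner: "inner (cycle_graph n) = {..<n}"
      using degree_cycle_graph[OF assms(1)] by (auto simp: inner_def cycle_graph_def)
    \<comment> \<open>The cycle is not a path forest, so the induction only applies after Right's
      move; \<open>inner_after_Right\<close> covers that move, as all \<open>n \<ge> 3\<close>
      vertices are inner.\<close>
    have "inner (cycle_graph n) \<notin> edges (cycle_graph n)"
      using inner fsg assms(1) by (auto simp: finite_simple_graph_def)
    moreover have "1 \<le> degree (cycle_graph n) v" if "v \<in> verts (cycle_graph n)" for v
      using degree_cycle_graph[OF assms(1)] that by (auto simp: cycle_graph_def)
    ultimately have "wins Left Left H" if "legal_move Right (cycle_graph n) H" for H
      using inner_after_Right[OF fsg] Left_wins_path_forest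
        path_forest_cycle_legal_move[OF assms(1) that] that by blast
    then show ?thesis
      using opponent_turn[of Left "cycle_graph n"] Right by simp
  qed
qed

end
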